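(* There exists an absolute constant $c>0$ such that the following holds. Suppose that for every $y\in\mathcal{Y}$ the map $x\in\mathcal{X}\mapsto l(x,y)$ is $L$-Lipschitz and $\rho$-strongly convex, let $B:=8L^2/\rho^2$, let $\delta\in(0,1)$ be fixed, and let $T\ge 1$ be the number of training rounds, in each of which the advice of all $K$ experts and the target are observed. Let $\alpha:=\sqrt{\log(4K\delta^{-1})/T}$ and, for $i,j\in\{1,\dots,K\}$, $$\Delta_{ij}:=\hat R(F_j)-\hat R(F_i)-6\alpha\max\{L\hat d_{ij},B\alpha\},\qquad S:=\Big\{j\in\{1,\dots,K\}:\ \sup_{i\in\{1,\dots,K\}}\Delta_{ij}\le 0\Big\}.$$ Choose $\bar k\in S$ arbitrarily, pick $\bar j\in\arg\max_{j\in S}\hat d_{\bar k j}$, and set $\widehat F:=\frac12(F_{\bar k}+F_{\bar j})$. Then with probability at least $1-3\delta$ over the training phase, $$R(\widehat F)\le R^*+cB\,\frac{\log(4K\delta^{-1})}{T}.$$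
   Context: Setting: $\mathcal{X}\subseteq\mathbb{R}^d$ is a nonempty closed convex set, $\mathcal{Y}$ is the target space, $l:\mathcal{X}\times\mathcal{Y}\to\mathbb{R}$ is a loss function, and $L,\rho>0$. A function $f:\mathcal{X}\to\mathbb{R}$ is $L$-Lipschitz if $|f(x)-f(y)|\le L\|x-y\|$ for all $x,y\in\mathcal{X}$ (Euclidean norm), and it is called $\rho$-strongly convex if $x\mapsto f(x)-\frac{\rho^2}{2}\|x\|^2$ is convex on $\mathcal{X}$ (note the square on $\rho$). The target $Y$ is a $\mathcal{Y}$-valued random variable and the experts $F_1,\dots,F_K$ are $\mathcal{X}$-valued random variables, jointly distributed with $Y$. The training data $(Y_t,F_{1,t},\dots,F_{K,t})_{1\le t\le T}$ are i.i.d. copies of $(Y,F_1,\dots,F_K)$. The risk of a forecast $F$ is $R(F):=\mathbb{E}[l(F,Y)]$ (assumed well defined); for a forecast which is a combination of experts with training-data-dependent weights, $R$ is evaluated on a new draw of $(Y,F_1,\dots,F_K)$ independent of the training data, i.e. conditionally on the training data. $R^*:=\min_{1\le i\le K}R(F_i)$. The empirical quantities are $\hat R(F_i):=\frac1T\sum_{t=1}^T l(F_{i,t},Y_t)$ and $\hat d_{ij}:=\big(\frac1T\sum_{t=1}^T (F_{i,t}-F_{j,t})^2\big)^{1/2}$, where for vectors $(F-G)^2$ means $\|F-G\|^2$. *)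

theory Defs
  imports "HOL-Probability.Probability"
begin

(* The modulus enters squared. *)
definition strongly_convex_on :: "real \<Rightarrow> (real ^ 'd) set \<Rightarrow> (real ^ 'd \<Rightarrow> real) \<Rightarrow> bool" where
  "strongly_convex_on \<rho> X f \<longleftrightarrow> convex_on X (\<lambda>x. f x - \<rho>\<^sup>2 / 2 * (norm x)\<^sup>2)"

(* Only the law of (Y, G) matters, so the risk of a combination with data-dependent weights is
   obtained by freezing the weights at their realised value: this is the risk on an independent
   new draw, conditionally on the training data. *)
definition risk :: "'w measure \<Rightarrow> (real ^ 'd \<Rightarrow> 'y \<Rightarrow> real) \<Rightarrow> ('w \<Rightarrow> 'y) \<Rightarrow> ('w \<Rightarrow> real ^ 'd) \<Rightarrow> real" where
  "risk M l Y G = (\<integral>\<omega>. l (G \<omega>) (Y \<omega>) \<partial>M)"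

definition best_risk ::
    "'w measure \<Rightarrow> (real ^ 'd \<Rightarrow> 'y \<Rightarrow> real) \<Rightarrow> nat \<Rightarrow> ('w \<Rightarrow> 'y) \<Rightarrow> (nat \<Rightarrow> 'w \<Rightarrow> real ^ 'd) \<Rightarrow> real" where
  "best_risk M l K Y F = Min ((\<lambda>i. risk M l Y (F i)) ` {1..K})"

(* State space and joint random element of the target together with the K experts. *)
definition obs_space :: "'y measure \<Rightarrow> (real ^ 'd) set \<Rightarrow> nat \<Rightarrow> ('y \<times> (nat \<Rightarrow> real ^ 'd)) measure" where
  "obs_space N X K = N \<Otimes>\<^sub>M (\<Pi>\<^sub>M i\<in>{1..K}. restrict_space borel X)"

definition obs ::
    "nat \<Rightarrow> ('w \<Rightarrow> 'y) \<Rightarrow> (nat \<Rightarrow> 'w \<Rightarrow> real ^ 'd) \<Rightarrow> 'w \<Rightarrow> 'y \<times> (nat \<Rightarrow> real ^ 'd)" where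
  "obs K Y F = (\<lambda>\<omega>. (Y \<omega>, \<lambda>i\<in>{1..K}. F i \<omega>))"

(* The training data (Ys t, Fs 1 t, ..., Fs K t), t = 1..T, are i.i.d. copies of
   (Y, F 1, ..., F K).  The experts of one round may depend on each other and on the target;
   indep_vars also contains the measurability of the training data. *)
definition iid_copies ::
    "'w measure \<Rightarrow> 'y measure \<Rightarrow> (real ^ 'd) set \<Rightarrow> nat \<Rightarrow> nat \<Rightarrow> ('w \<Rightarrow> 'y) \<Rightarrow> (nat \<Rightarrow> 'w \<Rightarrow> real ^ 'd)
      \<Rightarrow> (nat \<Rightarrow> 'w \<Rightarrow> 'y) \<Rightarrow> (nat \<Rightarrow> nat \<Rightarrow> 'w \<Rightarrow> real ^ 'd) \<Rightarrow> bool" where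
  "iid_copies M N X K T Y F Ys Fs \<longleftrightarrow>
     prob_space.indep_vars M (\<lambda>_. obs_space N X K) (\<lambda>t. obs K (Ys t) (\<lambda>i. Fs i t)) {1..T} \<and>
     (\<forall>t\<in>{1..T}. distr M (obs_space N X K) (obs K (Ys t) (\<lambda>i. Fs i t))
                = distr M (obs_space N X K) (obs K Y F))"

(* Below, ys t and fs i t are realised training data: the target and the advice of expert i
   in round t. *)
definition emp_risk :: "(real ^ 'd \<Rightarrow> 'y \<Rightarrow> real) \<Rightarrow> nat \<Rightarrow> (nat \<Rightarrow> 'y) \<Rightarrow> (nat \<Rightarrow> nat \<Rightarrow> real ^ 'd) \<Rightarrow> nat \<Rightarrow> real" where
  "emp_risk l T ys fs i = 1 / real T * (\<Sum>t=1..T. l (fs i t) (ys t))"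

definition emp_dist :: "nat \<Rightarrow> (nat \<Rightarrow> nat \<Rightarrow> real ^ 'd) \<Rightarrow> nat \<Rightarrow> nat \<Rightarrow> real" where
  "emp_dist T fs i j = sqrt (1 / real T * (\<Sum>t=1..T. (norm (fs i t - fs j t))\<^sup>2))"

definition Bconst :: "real \<Rightarrow> real \<Rightarrow> real" where
  "Bconst L \<rho> = 8 * L\<^sup>2 / \<rho>\<^sup>2"

definition alpha :: "nat \<Rightarrow> nat \<Rightarrow> real \<Rightarrow> real" where
  "alpha K T \<delta> = sqrt (ln (4 * real K / \<delta>) / real T)"

definition Delta ::
    "(real ^ 'd \<Rightarrow> 'y \<Rightarrow> real) \<Rightarrow> real \<Rightarrow> real \<Rightarrow> real \<Rightarrow> nat \<Rightarrow> nat
      \<Rightarrow> (nat \<Rightarrow> 'y) \<Rightarrow> (nat \<Rightarrow> nat \<Rightarrow> real ^ 'd) \<Rightarrow> nat \<Rightarrow> nat \<Rightarrow> real" where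
  "Delta l L \<rho> \<delta> K T ys fs i j =
     emp_risk l T ys fs j - emp_risk l T ys fs i
     - 6 * alpha K T \<delta> * max (L * emp_dist T fs i j) (Bconst L \<rho> * alpha K T \<delta>)"

definition selected ::
    "(real ^ 'd \<Rightarrow> 'y \<Rightarrow> real) \<Rightarrow> real \<Rightarrow> real \<Rightarrow> real \<Rightarrow> nat \<Rightarrow> nat
      \<Rightarrow> (nat \<Rightarrow> 'y) \<Rightarrow> (nat \<Rightarrow> nat \<Rightarrow> real ^ 'd) \<Rightarrow> nat set" where
  "selected l L \<rho> \<delta> K T ys fs =
     {j \<in> {1..K}. (SUP i\<in>{1..K}. Delta l L \<rho> \<delta> K T ys fs i j) \<le> 0}"

(* The pairs (k, j) the procedure may end up with: k is any selected expert, j any selected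
   expert at maximal empirical distance from k. *)
definition valid_choice ::
    "(real ^ 'd \<Rightarrow> 'y \<Rightarrow> real) \<Rightarrow> real \<Rightarrow> real \<Rightarrow> real \<Rightarrow> nat \<Rightarrow> nat
      \<Rightarrow> (nat \<Rightarrow> 'y) \<Rightarrow> (nat \<Rightarrow> nat \<Rightarrow> real ^ 'd) \<Rightarrow> nat \<Rightarrow> nat \<Rightarrow> bool" where
  "valid_choice l L \<rho> \<delta> K T ys fs k j \<longleftrightarrow>
     k \<in> selected l L \<rho> \<delta> K T ys fs \<and>
     is_arg_max (emp_dist T fs k) (\<lambda>j. j \<in> selected l L \<rho> \<delta> K T ys fs) j"

(* A constant bound by an existential may depend on the type variables of the statement (hence
   on the dimension CARD('d)).  Since the risk bound is monotone in the constant, requiring it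
   to be at most this fixed number forces one constant to serve for all types. *)
definition abs_const_bound :: real where
  "abs_const_bound = 1000"

end

theory Submission
  imports Defs
begin

text \<open>
  Lipschitz growth is linear and strong convexity quadratic, so \<open>X\<close> has diameter at most
  \<open>D = 4 L / \<rho>\<^sup>2\<close>, and loss differences are bounded by \<open>L D = B / 2\<close>. Exponential Markov inequalities
  show that, outside an event of probability at most \<open>3 \<delta>\<close>, for all pairs of experts the empirical
  risk difference deviates from the true one by at most \<open>3 \<alpha> max (L d) (B \<alpha>)\<close>, where \<open>d\<close> is the
  \<open>L\<^sup>2\<close> distance of the two experts, and \<open>d\<^sup>2\<close> agrees with its empirical version up to a factor 2 and
  an additive \<open>O(D\<^sup>2 \<alpha>\<^sup>2)\<close>. On this event the best expert is selected. As the two experts that are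
  averaged are almost as far apart as the selected set is wide, each has excess risk
  \<open>O(\<alpha> L d + B \<alpha>\<^sup>2)\<close> for their distance \<open>d\<close>, and the gain \<open>\<rho>\<^sup>2 d\<^sup>2 / 8\<close> from strong convexity at the midpoint
  absorbs the term \<open>\<alpha> L d\<close> by AM-GM.
\<close>

section \<open>Elementary inequalities for the exponential function\<close>

lemma exp_le_quadratic:
  fixes x :: real
  assumes "\<bar>x\<bar> \<le> 1"
  shows "exp x \<le> 1 + x + x\<^sup>2"
proof (cases "0 \<le> x")
  case True
  then show ?thesis using exp_bound[of x] assms by simp
next
  case False
  define y where "y = - x"
  have y: "0 \<le> y" "y \<le> 1" using False assms by (auto simp: y_def)
  \<comment> \<open>By the sum-of-cubes factorisation the product is 1 plus the cube of
    \<open>y\<close>, and \<open>y\<close> is nonnegative.\<close>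
  have "1 \<le> (1 + y) * (1 - y + y\<^sup>2)"
    using y by (simp add: algebra_simps power2_eq_square)
  also have "\<dots> \<le> exp y * (1 - y + y\<^sup>2)"
    using y exp_ge_add_one_self[of y] by (intro mult_right_mono) auto
  finally have "exp (- y) \<le> 1 - y + y\<^sup>2"
    by (simp add: exp_minus field_simps)
  then show ?thesis by (simp add: y_def)
qed

text \<open>Multiplying by \<open>exp x\<close>, which is at least \<open>1 + x\<close>, reduces the
  claim to a polynomial inequality that amounts to \<open>x * x \<le> x\<close>.\<close>

lemma exp_minus_le_linear:
  fixes x :: real
  assumes "0 \<le> x" "x \<le> 1"
  shows "exp (- x) \<le> 1 - x / 2"
proof -
  have "x * x \<le> x" using assms mult_left_le[of x x] by simp
  then have "1 \<le> (1 + x) * (1 - x / 2)"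
    by (simp add: algebra_simps)
  also have "\<dots> \<le> exp x * (1 - x / 2)"
    using assms by (intro mult_right_mono) auto
  finally show ?thesis by (simp add: exp_minus field_simps)
qed

lemma exp_le_linear:
  fixes x :: real
  assumes "0 \<le> x" "x \<le> 1"
  shows "exp x \<le> 1 + 2 * x"
  using exp_le_quadratic[of x] assms mult_left_le[of x x] by (simp add: power2_eq_square)

section \<open>Strongly convex Lipschitz functions\<close>

text \<open>Ordinary midpoint convexity of \<open>f\<close> minus its quadratic part. By the
  parallelogram identity the quadratic part loses a quarter of the squared distance at the midpoint,
  which turns the factor \<open>\<rho>\<^sup>2 / 2\<close> into
  \<open>\<rho>\<^sup>2 / 8\<close>.\<close>

lemma strongly_convex_on_midpoint:
  assumes "strongly_convex_on \<rho> X f" "x \<in> X" "y \<in> X"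
  shows "f ((1/2) *\<^sub>R (x + y)) \<le> (f x + f y) / 2 - \<rho>\<^sup>2 / 8 * (norm (x - y))\<^sup>2"
proof -
  define g where "g = (\<lambda>x. f x - \<rho>\<^sup>2 / 2 * (norm x)\<^sup>2)"
  have "convex_on X g"
    using assms(1) by (simp add: strongly_convex_on_def g_def)
  from convex_onD[OF this, of "1/2" x y] assms(2,3)
  have "g ((1/2) *\<^sub>R (x + y)) \<le> (g x + g y) / 2"
    by (simp add: scaleR_add_right)
  moreover have sq: "(norm ((1/2) *\<^sub>R (x + y)))\<^sup>2 = ((norm x)\<^sup>2 + (norm y)\<^sup>2) / 2 - (norm (x - y))\<^sup>2 / 4"
    by (simp only: power2_norm_eq_inner) (simp add: inner_simps inner_commute field_simps)
  have "\<rho>\<^sup>2 / 2 * (norm ((1/2) *\<^sub>R (x + y)))\<^sup>2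
      = \<rho>\<^sup>2 / 2 * (norm x)\<^sup>2 / 2 + \<rho>\<^sup>2 / 2 * (norm y)\<^sup>2 / 2 - \<rho>\<^sup>2 / 8 * (norm (x - y))\<^sup>2"
    unfolding sq by (simp add: algebra_simps)
  ultimately show ?thesis
    unfolding g_def by argo
qed

text \<open>At the midpoint strong convexity forces \<open>f\<close> below the average of its end
  values by an amount quadratic in the distance, while the Lipschitz condition permits only a linear
  drop. Comparing the two bounds the distance.\<close>

lemma strongly_convex_lipschitz_diameter:
  assumes "strongly_convex_on \<rho> X f" "L-lipschitz_on X f" "convex X" "x \<in> X" "y \<in> X" "0 < \<rho>"
  shows "norm (x - y) \<le> 4 * L / \<rho>\<^sup>2"
proof -
  define m where "m = (1/2) *\<^sub>R (x + y)"
  have m: "m \<in> X"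
    using convexD[OF assms(3-5), of "1/2" "1/2"] by (simp add: m_def scaleR_add_right)
  have "x - m = (1/2) *\<^sub>R (x - y)" "y - m = - ((1/2) *\<^sub>R (x - y))"
    by (auto simp: m_def scaleR_add_right scaleR_diff_right algebra_simps simp flip: scaleR_add_left)
  then have "\<bar>f x - f m\<bar> \<le> L * (norm (x - y) / 2)" "\<bar>f y - f m\<bar> \<le> L * (norm (x - y) / 2)"
    using lipschitz_on_normD[OF assms(2) _ m, of x] lipschitz_on_normD[OF assms(2) _ m, of y] assms(4,5)
    by auto
  then have "f x - f m \<le> L * (norm (x - y) / 2)" "f y - f m \<le> L * (norm (x - y) / 2)"
    by linarith+
  with strongly_convex_on_midpoint[OF assms(1,4,5), folded m_def]
  have "\<rho>\<^sup>2 / 8 * (norm (x - y))\<^sup>2 \<le> L * norm (x - y) / 2"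
    by (simp add: field_simps)
  then have *: "\<rho>\<^sup>2 * norm (x - y) * norm (x - y) \<le> 4 * L * norm (x - y)"
    by (simp add: power2_eq_square field_simps)
  have "0 \<le> L" using assms(2) by (rule lipschitz_on_nonneg)
  \<comment> \<open>One factor \<open>norm (x - y)\<close> is cancelled; if it vanishes, the claim
    is just nonnegativity of \<open>L\<close>.\<close>
  then have "\<rho>\<^sup>2 * norm (x - y) \<le> 4 * L"
    using * by (cases "norm (x - y) = 0") auto
  then show ?thesis
    using \<open>0 < \<rho>\<close> by (simp add: field_simps)
qed

section \<open>Exponential moments and a Chernoff bound\<close>

context prob_space
begin

text \<open>A Bernstein-type bound. The exponent \<open>s * (Z x - \<mu>)\<close> has absolute value
  at most 1, so the quadratic bound on \<open>exp\<close> applies pointwise; the linear term has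
  mean zero, and the variance is at most the second moment and hence at most \<open>w\<close>. The
  correction is put inside the exponential so that the bound 1 is preserved by products over
  independent rounds.\<close>

lemma expectation_exp_bernstein_le_1:
  fixes Z :: "'a \<Rightarrow> real"
  assumes [measurable]: "Z \<in> borel_measurable M"
    and bound: "\<And>x. x \<in> space M \<Longrightarrow> \<bar>Z x\<bar> \<le> b" and s: "0 \<le> s" "2 * b * s \<le> 1"
    and w: "expectation (\<lambda>x. (Z x)\<^sup>2) \<le> w"
  shows "expectation (\<lambda>x. exp (s * (Z x - expectation Z) - s\<^sup>2 * w)) \<le> 1"
proof -
  define \<mu> where "\<mu> = expectation Z"
  have int[simp]: "integrable M Z"
    by (rule integrable_const_bound[of _ b]) (auto simp: bound)
  have \<mu>: "\<bar>\<mu>\<bar> \<le> b"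
  proof -
    have "\<bar>\<mu>\<bar> \<le> expectation (\<lambda>x. \<bar>Z x\<bar>)"
      unfolding \<mu>_def by (rule integral_abs_bound)
    also have "\<dots> \<le> expectation (\<lambda>x. b)"
      by (intro integral_mono) (auto simp: bound)
    finally show ?thesis by (simp add: prob_space)
  qed
  have small: "\<bar>s * (Z x - \<mu>)\<bar> \<le> 1" if "x \<in> space M" for x
  proof -
    have "\<bar>Z x - \<mu>\<bar> \<le> 2 * b" using bound[OF that] \<mu> by linarith
    then have "s * \<bar>Z x - \<mu>\<bar> \<le> s * (2 * b)" using s(1) by (rule mult_left_mono)
    then show ?thesis using s by (simp add: abs_mult mult_ac)
  qed
  have intsq: "integrable M (\<lambda>x. (Z x)\<^sup>2)"
    by (rule integrable_const_bound[of _ "b\<^sup>2"]) (auto simp: bound abs_le_square_iff[symmetric] intro!: order.trans[OF bound])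
  have var: "expectation (\<lambda>x. (Z x - \<mu>)\<^sup>2) \<le> w" "integrable M (\<lambda>x. (Z x - \<mu>)\<^sup>2)"
  proof -
    show "integrable M (\<lambda>x. (Z x - \<mu>)\<^sup>2)"
      using intsq by (simp add: power2_diff)
    show "expectation (\<lambda>x. (Z x - \<mu>)\<^sup>2) \<le> w"
      using variance_eq[OF int intsq] w unfolding \<mu>_def
      by (smt (verit) zero_le_power2)
  qed
  have intexp: "integrable M (\<lambda>x. exp (s * (Z x - \<mu>)))"
    by (rule integrable_const_bound[of _ "exp 1"]) (use small in \<open>auto simp: abs_le_iff\<close>)
  have "expectation (\<lambda>x. exp (s * (Z x - \<mu>)))
      \<le> expectation (\<lambda>x. 1 + s * (Z x - \<mu>) + (s * (Z x - \<mu>))\<^sup>2)"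
    by (intro integral_mono intexp exp_le_quadratic small)
       (use var in \<open>auto simp: power_mult_distrib\<close>)
  also have "\<dots> = 1 + s\<^sup>2 * expectation (\<lambda>x. (Z x - \<mu>)\<^sup>2)"
    using var by (simp add: power_mult_distrib prob_space \<mu>_def)
  also have "\<dots> \<le> 1 + s\<^sup>2 * w"
    using var by (simp add: mult_left_mono)
  also have "\<dots> \<le> exp (s\<^sup>2 * w)" by simp
  finally show ?thesis
    by (simp add: exp_diff \<mu>_def[symmetric])
qed

text \<open>For a variable with values in the unit interval a linear bound on \<open>exp\<close>
  suffices, so the mean takes the place of the variance. The price is the factor 2 on the mean, as
  in multiplicative Chernoff bounds.\<close>

lemma expectation_exp_upper_le_1:
  fixes Z :: "'a \<Rightarrow> real"
  assumes [measurable]: "Z \<in> borel_measurable M"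
    and bound: "\<And>x. x \<in> space M \<Longrightarrow> 0 \<le> Z x \<and> Z x \<le> 1"
  shows "expectation (\<lambda>x. exp (Z x - 2 * expectation Z)) \<le> 1"
proof -
  have int[simp]: "integrable M Z"
    by (rule integrable_const_bound[of _ 1]) (auto simp: bound)
  have "integrable M (\<lambda>x. exp (Z x))"
    by (rule integrable_const_bound[of _ "exp 1"]) (auto simp: bound)
  then have "expectation (\<lambda>x. exp (Z x)) \<le> expectation (\<lambda>x. 1 + 2 * Z x)"
    by (intro integral_mono exp_le_linear) (auto simp: bound)
  also have "\<dots> = 1 + 2 * expectation Z" by (simp add: prob_space)
  also have "\<dots> \<le> exp (2 * expectation Z)" by simp
  finally show ?thesis by (simp add: exp_diff)
qed

text \<open>The lower-tail counterpart, based on the linear bound for \<open>exp (- x)\<close>; here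
  half of the mean is lost.\<close>

lemma expectation_exp_lower_le_1:
  fixes Z :: "'a \<Rightarrow> real"
  assumes [measurable]: "Z \<in> borel_measurable M"
    and bound: "\<And>x. x \<in> space M \<Longrightarrow> 0 \<le> Z x \<and> Z x \<le> 1"
  shows "expectation (\<lambda>x. exp (expectation Z / 2 - Z x)) \<le> 1"
proof -
  have int[simp]: "integrable M Z"
    by (rule integrable_const_bound[of _ 1]) (auto simp: bound)
  have "integrable M (\<lambda>x. exp (- Z x))"
    by (rule integrable_const_bound[of _ 1]) (auto simp: bound)
  then have "expectation (\<lambda>x. exp (- Z x)) \<le> expectation (\<lambda>x. 1 - Z x / 2)"
    by (intro integral_mono exp_minus_le_linear) (auto simp: bound)
  also have "\<dots> = 1 - expectation Z / 2" by (simp add: prob_space)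
  also have "\<dots> \<le> exp (- (expectation Z / 2))"
    using exp_ge_add_one_self[of "- (expectation Z / 2)"] by simp
  finally have "expectation (\<lambda>x. exp (- Z x)) * exp (expectation Z / 2) \<le> 1"
    by (simp add: exp_minus field_simps)
  moreover have "expectation (\<lambda>x. exp (expectation Z / 2 - Z x)) = expectation (\<lambda>x. exp (- Z x)) * exp (expectation Z / 2)"
    by (subst integral_mult_left_zero[symmetric]) (simp add: mult_exp_exp)
  ultimately show ?thesis by simp
qed

text \<open>Markov's inequality for the exponential of the sum: independence factorises its
  expectation into terms that are each at most 1. The bound \<open>C\<close> provides integrability
  of the factors.\<close>

lemma chernoff_iid:
  assumes indep: "indep_vars (\<lambda>_. S) Z I" and I: "finite I"
    and law: "\<And>t. t \<in> I \<Longrightarrow> distr M S (Z t) = P"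
    and g[measurable]: "g \<in> borel_measurable S"
    and bound: "\<And>z. z \<in> space S \<Longrightarrow> g z \<le> C"
    and mgf: "(\<integral>z. exp (g z) \<partial>P) \<le> 1"
  shows "prob {\<omega>\<in>space M. x \<le> (\<Sum>t\<in>I. g (Z t \<omega>))} \<le> exp (- x)"
proof -
  have Z[measurable]: "Z t \<in> M \<rightarrow>\<^sub>M S" if "t \<in> I" for t
    using indep that by (auto simp: indep_vars_def)
  have ind: "indep_vars (\<lambda>_. borel) (\<lambda>t \<omega>. exp (g (Z t \<omega>))) I"
    by (rule indep_vars_compose2[OF indep]) measurable
  have int: "integrable M (\<lambda>\<omega>. exp (g (Z t \<omega>)))" if "t \<in> I" for t
    using that bound measurable_space[OF Z[OF that]]
    by (intro integrable_const_bound[of _ "exp C"]) auto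
  have one: "expectation (\<lambda>\<omega>. exp (g (Z t \<omega>))) \<le> 1" if "t \<in> I" for t
    using mgf law[OF that, symmetric] that by (simp add: integral_distr)
  have exp_sum: "exp (\<Sum>t\<in>I. g (Z t \<omega>)) = (\<Prod>t\<in>I. exp (g (Z t \<omega>)))" for \<omega>
    using I by (simp add: exp_sum)
  have prod: "expectation (\<lambda>\<omega>. exp (\<Sum>t\<in>I. g (Z t \<omega>))) \<le> 1"
    unfolding exp_sum
    by (subst indep_vars_lebesgue_integral[OF I ind int]) (auto intro!: prod_le_1 one)
  have intp: "integrable M (\<lambda>\<omega>. exp (\<Sum>t\<in>I. g (Z t \<omega>)))"
    unfolding exp_sum by (rule indep_vars_integrable[OF I ind int])
  have "prob {\<omega>\<in>space M. x \<le> (\<Sum>t\<in>I. g (Z t \<omega>))}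
      = prob {\<omega>\<in>space M. exp x \<le> exp (\<Sum>t\<in>I. g (Z t \<omega>))}" by simp
  also have "\<dots> \<le> expectation (\<lambda>\<omega>. exp (\<Sum>t\<in>I. g (Z t \<omega>))) / exp x"
    by (rule integral_Markov_inequality_measure[OF intp, of "{}"]) auto
  also have "\<dots> \<le> 1 / exp x"
    using prod by (intro divide_right_mono) auto
  finally show ?thesis by (simp add: exp_minus field_simps)
qed

end

section \<open>Empirical distance and the selected set\<close>

lemma emp_dist_commute: "emp_dist T fs i j = emp_dist T fs j i"
  by (simp add: emp_dist_def norm_minus_commute)

lemma emp_dist_nonneg: "0 \<le> emp_dist T fs i j"
  by (simp add: emp_dist_def sum_nonneg)

text \<open>Up to the factor \<open>sqrt (1 / real T)\<close> the empirical distance is an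
  \<open>L2_set\<close> norm, so this is Minkowski's inequality after the pointwise triangle
  inequality.\<close>

lemma emp_dist_triangle: "emp_dist T fs i j \<le> emp_dist T fs i k + emp_dist T fs k j"
proof -
  have *: "emp_dist T fs i j = sqrt (1 / real T) * L2_set (\<lambda>t. norm (fs i t - fs j t)) {1..T}" for i j
    by (simp add: emp_dist_def L2_set_def flip: real_sqrt_mult)
  have "L2_set (\<lambda>t. norm (fs i t - fs j t)) {1..T}
      \<le> L2_set (\<lambda>t. norm (fs i t - fs k t) + norm (fs k t - fs j t)) {1..T}"
    by (intro L2_set_mono) (simp_all add: dist_triangle flip: dist_norm)
  also have "\<dots> \<le> L2_set (\<lambda>t. norm (fs i t - fs k t)) {1..T} + L2_set (\<lambda>t. norm (fs k t - fs j t)) {1..T}"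
    by (rule L2_set_triangle_ineq)
  finally show ?thesis unfolding * distrib_left[symmetric]
    by (intro mult_left_mono) auto
qed

text \<open>The supremum is taken in a conditionally complete order; \<open>1 \<le> K\<close> makes
  its finite index set nonempty, so the usual characterisation of upper bounds applies.\<close>

lemma mem_selected_iff:
  assumes "1 \<le> K"
  shows "j \<in> selected l L \<rho> \<delta> K T ys fs \<longleftrightarrow>
    j \<in> {1..K} \<and> (\<forall>i\<in>{1..K}. Delta l L \<rho> \<delta> K T ys fs i j \<le> 0)"
  unfolding selected_def using assms by (subst mem_Collect_eq, subst cSUP_le_iff) auto


section \<open>Deterministic analysis of the selection rule\<close>

text \<open>Free of probability: \<open>R\<close> stands for the true risks and \<open>Q\<close> for
  the expected squared distances, while \<open>dev\<close>, \<open>low\<close> and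
  \<open>upp\<close> are the inequalities that will hold outside the exceptional event.\<close>

lemma aggregation_bound:
  fixes R :: "nat \<Rightarrow> real" and Q :: "nat \<Rightarrow> nat \<Rightarrow> real"
    and L \<rho> \<delta> :: real and K T :: nat
  defines "a \<equiv> alpha K T \<delta>" and "B \<equiv> Bconst L \<rho>" and "D \<equiv> 4 * L / \<rho>\<^sup>2"
  assumes K: "1 \<le> K" and L: "0 < L" and \<rho>: "0 < \<rho>" and a: "0 < a"
    and dev: "\<And>i j. i \<in> {1..K} \<Longrightarrow> j \<in> {1..K} \<Longrightarrow>
      (emp_risk l T ys fs i - emp_risk l T ys fs j) - (R i - R j) \<le> 3 * a * max (L * sqrt (Q i j)) (B * a)"
    and low: "\<And>i j. i \<in> {1..K} \<Longrightarrow> j \<in> {1..K} \<Longrightarrow>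
      Q i j / 2 \<le> (emp_dist T fs i j)\<^sup>2 + 2 * D\<^sup>2 * a\<^sup>2"
    and upp: "\<And>i j. i \<in> {1..K} \<Longrightarrow> j \<in> {1..K} \<Longrightarrow>
      (emp_dist T fs i j)\<^sup>2 \<le> 2 * Q i j + 2 * D\<^sup>2 * a\<^sup>2"
    and best: "m \<in> {1..K}" "\<And>i. i \<in> {1..K} \<Longrightarrow> R m \<le> R i"
    and choice: "valid_choice l L \<rho> \<delta> K T ys fs k j"
  shows "(R k + R j) / 2 - \<rho>\<^sup>2 / 8 * Q k j \<le> R m + 200 * B * a\<^sup>2"
proof -
  let ?d = "emp_dist T fs" and ?r = "emp_risk l T ys fs" and ?S = "selected l L \<rho> \<delta> K T ys fs"
  have B: "0 < B" using L \<rho> by (simp add: B_def Bconst_def)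
  have LD: "L * D = B / 2"
    using \<rho> by (simp add: D_def B_def Bconst_def field_simps power2_eq_square)
  \<comment> \<open>The expected distance is replaced by the empirical one. Since
    \<open>L\<^sup>2 * Q i j\<close> is at most \<open>3 * M\<^sup>2\<close>, the maximum at most
    doubles, and 3 becomes the constant 6 of \<open>Delta\<close>.\<close>
  have dev': "(?r i - ?r j) - (R i - R j) \<le> 6 * a * max (L * ?d i j) (B * a)"
    if ij: "i \<in> {1..K}" "j \<in> {1..K}" for i j
  proof -
    define M where "M = max (L * ?d i j) (B * a)"
    have M: "L * ?d i j \<le> M" "B * a \<le> M" "0 \<le> M"
      using B a by (auto simp: M_def le_max_iff_disj)
    have "L\<^sup>2 * Q i j \<le> 2 * (L * ?d i j)\<^sup>2 + 4 * (L * D)\<^sup>2 * a\<^sup>2"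
      using mult_left_mono[OF low[OF ij], of "2 * L\<^sup>2"] by (simp add: algebra_simps power_mult_distrib)
    also have "\<dots> = 2 * (L * ?d i j)\<^sup>2 + (B * a)\<^sup>2"
      unfolding LD by (simp add: power_mult_distrib power_divide)
    also have "\<dots> \<le> 2 * M\<^sup>2 + M\<^sup>2"
      using M B a L emp_dist_nonneg[of T fs i j] by (intro add_mono mult_left_mono power_mono) auto
    also have "\<dots> \<le> (2 * M)\<^sup>2"
      by (simp add: power_mult_distrib)
    finally have "sqrt (L\<^sup>2 * Q i j) \<le> 2 * M"
      using M by (intro real_le_lsqrt) auto
    then have "L * sqrt (Q i j) \<le> 2 * M"
      using L by (simp add: real_sqrt_mult)
    then have "max (L * sqrt (Q i j)) (B * a) \<le> 2 * M" using M by auto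
    then have "3 * a * max (L * sqrt (Q i j)) (B * a) \<le> 3 * a * (2 * M)"
      using a by (intro mult_left_mono) auto
    with dev[OF ij] show ?thesis by (simp add: M_def)
  qed
  have sel: "i \<in> ?S \<longleftrightarrow> i \<in> {1..K} \<and>
      (\<forall>i'\<in>{1..K}. ?r i - ?r i' \<le> 6 * a * max (L * ?d i' i) (B * a))" for i
    unfolding mem_selected_iff[OF K] Delta_def a_def B_def by (auto simp: algebra_simps)
  \<comment> \<open>As \<open>R m - R i\<close> is never positive, \<open>dev'\<close> bounds the
    empirical excess of \<open>m\<close> by exactly the selection threshold.\<close>
  have m: "m \<in> ?S"
  proof -
    have "?r m - ?r i \<le> 6 * a * max (L * ?d i m) (B * a)" if "i \<in> {1..K}" for i
      using dev'[of m i] best that emp_dist_commute[of T fs m i] by fastforce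
    then show ?thesis using sel best by auto
  qed
  have k: "k \<in> ?S" and j: "j \<in> ?S" and far: "?d k i \<le> ?d k j" if "i \<in> ?S" for i
    using choice m that by (auto simp: valid_choice_def is_arg_max_def not_less)
  \<comment> \<open>One 6 comes from the selection test of \<open>i\<close> against
    \<open>m\<close>, the other from \<open>dev'\<close>.\<close>
  have excess: "R i - R m \<le> 12 * a * max (L * ?d m i) (B * a)" if "i \<in> ?S" for i
  proof -
    have "?r i - ?r m \<le> 6 * a * max (L * ?d m i) (B * a)" and "i \<in> {1..K}"
      using sel[of i] that best by auto
    with dev'[of m i] best show ?thesis by fastforce
  qed
  define e where "e = ?d k j"
  have e: "0 \<le> e" by (simp add: e_def emp_dist_nonneg)
  \<comment> \<open>The minimiser \<open>m\<close> is itself selected and \<open>j\<close> is a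
    farthest selected expert from \<open>k\<close>, so \<open>m\<close> is within \<open>e\<close>
    of \<open>k\<close>, and within \<open>2 * e\<close> of \<open>j\<close> by the triangle
    inequality.\<close>
  have dk: "?d m k \<le> e" using far[OF m] emp_dist_commute[of T fs m k] by (simp add: e_def)
  then have dj: "?d m j \<le> 2 * e"
    using emp_dist_triangle[of T fs m j k] by (simp add: e_def)
  \<comment> \<open>Replacing the maximum by the sum separates the term linear in \<open>e\<close>
    from the one of order \<open>B * a\<^sup>2\<close>.\<close>
  have max_le: "12 * a * max (L * x) (B * a) \<le> 12 * a * (L * y + B * a)"
    if "x \<le> y" "0 \<le> y" for x y
    using that a L B mult_left_mono[of x y L] by (intro mult_left_mono) (auto simp: add_increasing2)
  have "R k - R m \<le> 12 * a * (L * e + B * a)"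
    using excess[OF k[OF m]] max_le[OF dk e] by linarith
  then have "R k - R m \<le> 12 * (a * L * e) + 12 * (B * a\<^sup>2)"
    by (simp add: algebra_simps power2_eq_square)
  moreover have "R j - R m \<le> 12 * a * (L * (2 * e) + B * a)"
    using excess[OF j[OF m]] max_le[OF dj] e by linarith
  then have "R j - R m \<le> 24 * (a * L * e) + 12 * (B * a\<^sup>2)"
    by (simp add: algebra_simps power2_eq_square)
  moreover have "Q k j \<ge> e\<^sup>2 / 2 - D\<^sup>2 * a\<^sup>2"
    using upp[of k j] k[OF m] j[OF m] sel unfolding e_def by fastforce
  then have "\<rho>\<^sup>2 / 8 * Q k j \<ge> \<rho>\<^sup>2 / 8 * (e\<^sup>2 / 2 - D\<^sup>2 * a\<^sup>2)"
    by (intro mult_left_mono) auto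
  moreover have "\<rho>\<^sup>2 / 8 * (e\<^sup>2 / 2 - D\<^sup>2 * a\<^sup>2) = \<rho>\<^sup>2 * e\<^sup>2 / 16 - B * a\<^sup>2 / 4"
    using \<rho> by (simp add: B_def D_def Bconst_def field_simps power2_eq_square)
  \<comment> \<open>The coefficient 18 is the average of 12 and 24. The square below is chosen so
    that its cross term is \<open>18 * a * L * e\<close>; its last term is
    \<open>1296 * a\<^sup>2 * L\<^sup>2 / \<rho>\<^sup>2\<close>, which equals
    \<open>162 * (B * a\<^sup>2)\<close>.\<close>
  moreover have "18 * a * L * e \<le> \<rho>\<^sup>2 * e\<^sup>2 / 16 + 162 * (B * a\<^sup>2)"
  proof -
    have "0 \<le> (\<rho> * e / 4 - 36 * a * L / \<rho>)\<^sup>2" by simp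
    also have "\<dots> = \<rho>\<^sup>2 * e\<^sup>2 / 16 + 162 * (B * a\<^sup>2) - 18 * a * L * e"
      using \<rho> by (simp add: B_def Bconst_def field_simps power2_eq_square)
    finally show ?thesis by simp
  qed
  moreover have "0 \<le> B * a\<^sup>2" using B by simp
  \<comment> \<open>Abstracting the nonlinear terms leaves linear arithmetic. The coefficients of
    \<open>b\<close> add up to 12 + 1/4 + 162, which is below 200.\<close>
  moreover have "(Rk + Rj) / 2 - q \<le> Rm + 200 * b"
    if "Rk - Rm \<le> 12 * u + 12 * b" "Rj - Rm \<le> 24 * u + 12 * b" "p \<le> q" "p = x - b / 4"
      "18 * u \<le> x + 162 * b" "0 \<le> b" for Rk Rj Rm q b u p x :: real
    using that by argo
  ultimately show ?thesis by (simp only: mult.assoc)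
qed

section \<open>The statistical model and its constants\<close>

locale expert_aggregation = prob_space M for M :: "'w measure" +
  fixes X :: "(real ^ 'd) set" and N :: "'y measure" and l :: "real ^ 'd \<Rightarrow> 'y \<Rightarrow> real"
    and L \<rho> \<delta> :: real and K T :: nat
    and Y :: "'w \<Rightarrow> 'y" and F :: "nat \<Rightarrow> 'w \<Rightarrow> real ^ 'd"
    and Ys :: "nat \<Rightarrow> 'w \<Rightarrow> 'y" and Fs :: "nat \<Rightarrow> nat \<Rightarrow> 'w \<Rightarrow> real ^ 'd"
  assumes X: "convex X" and L: "0 < L" and \<rho>: "0 < \<rho>"
    and \<delta>: "0 < \<delta>" "\<delta> < 1" and K: "1 \<le> K" and T: "1 \<le> T"
    and l_measurable: "(\<lambda>(x, y). l x y) \<in> borel_measurable (restrict_space borel X \<Otimes>\<^sub>M N)"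
    and lipschitz: "\<And>y. y \<in> space N \<Longrightarrow> L-lipschitz_on X (\<lambda>x. l x y)"
    and strongly_convex: "\<And>y. y \<in> space N \<Longrightarrow> strongly_convex_on \<rho> X (\<lambda>x. l x y)"
    and Y[measurable]: "Y \<in> M \<rightarrow>\<^sub>M N"
    and F[measurable]: "\<And>i. i \<in> {1..K} \<Longrightarrow> F i \<in> M \<rightarrow>\<^sub>M restrict_space borel X"
    and integrable_loss: "\<And>i. i \<in> {1..K} \<Longrightarrow> integrable M (\<lambda>\<omega>. l (F i \<omega>) (Y \<omega>))"
    and iid: "iid_copies M N X K T Y F Ys Fs"
begin

abbreviation "S \<equiv> obs_space N X K"
abbreviation "sample t \<equiv> obs K (Ys t) (\<lambda>i. Fs i t)"
abbreviation "a \<equiv> alpha K T \<delta>"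
abbreviation "B \<equiv> Bconst L \<rho>"
abbreviation "R i \<equiv> risk M l Y (F i)"
abbreviation "emp_R i \<omega> \<equiv> emp_risk l T (\<lambda>t. Ys t \<omega>) (\<lambda>i t. Fs i t \<omega>) i"
abbreviation "emp_d i j \<omega> \<equiv> emp_dist T (\<lambda>i t. Fs i t \<omega>) i j"

definition "D = 4 * L / \<rho>\<^sup>2"
definition "law = distr M S (obs K Y F)"
text \<open>\<open>gap\<close> and \<open>sqd\<close> live on the observation space, so the same
  function can be integrated against the law of a new draw and summed over the training
  rounds.\<close>

definition "gap i j z = l (snd z i) (fst z) - l (snd z j) (fst z)"
definition sqd :: "nat \<Rightarrow> nat \<Rightarrow> 'y \<times> (nat \<Rightarrow> real ^ 'd) \<Rightarrow> real" where
  "sqd i j z = (norm (snd z i - snd z j))\<^sup>2"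
definition "Q i j = (\<integral>z. sqd i j z \<partial>law)"

lemma alpha_pos: "0 < a" and alpha_sq: "a\<^sup>2 = ln (4 * real K / \<delta>) / real T"
proof -
  have "4 * real K / \<delta> > 1"
    using K \<delta> by (simp add: field_simps)
  then have "ln (4 * real K / \<delta>) / real T > 0" using T by simp
  then show "0 < a" "a\<^sup>2 = ln (4 * real K / \<delta>) / real T" by (auto simp: alpha_def)
qed

lemma B_pos: "0 < B"
  using L \<rho> by (simp add: Bconst_def)

lemma L_mult_D: "L * D = B / 2"
  using \<rho> by (simp add: D_def Bconst_def field_simps power2_eq_square)

lemma D_pos: "0 < D"
  using L \<rho> by (simp add: D_def)

text \<open>This fixes the Chernoff level \<open>2 * a\<^sup>2\<close> per round: the resulting
  failure probability is quadratic in \<open>1 / real K\<close>, which pays for a union bound over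
  all pairs of experts.\<close>

lemma exp_alpha: "exp (- (2 * a\<^sup>2 * real T)) = (\<delta> / (4 * real K))\<^sup>2"
proof -
  have "0 < 4 * real K / \<delta>" using K \<delta> by simp
  moreover have "2 * a\<^sup>2 * real T = ln ((4 * real K / \<delta>)\<^sup>2)"
    using T \<open>0 < 4 * real K / \<delta>\<close> by (simp add: alpha_sq ln_realpow)
  ultimately have "exp (2 * a\<^sup>2 * real T) = (4 * real K / \<delta>)\<^sup>2"
    by (simp only: exp_ln zero_less_power)
  then show ?thesis
    by (simp add: exp_minus power_divide)
qed

section \<open>Measurability and bounds for a single observation\<close>

lemma space_S: "z \<in> space S \<Longrightarrow> fst z \<in> space N"
  "z \<in> space S \<Longrightarrow> i \<in> {1..K} \<Longrightarrow> snd z i \<in> X"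
  by (auto simp: obs_space_def space_pair_measure space_PiM space_restrict_space)

lemma target_measurable[measurable]: "fst \<in> S \<rightarrow>\<^sub>M N"
  by (simp add: obs_space_def)

lemma advice_measurable[measurable]:
  "i \<in> {1..K} \<Longrightarrow> (\<lambda>z. snd z i) \<in> S \<rightarrow>\<^sub>M restrict_space borel X"
  unfolding obs_space_def
  by (rule measurable_compose[OF measurable_snd measurable_component_singleton])

lemma loss_measurable:
  assumes "G \<in> A \<rightarrow>\<^sub>M restrict_space borel X" "V \<in> A \<rightarrow>\<^sub>M N"
  shows "(\<lambda>x. l (G x) (V x)) \<in> borel_measurable A"
  using measurable_compose[OF measurable_Pair[OF assms] l_measurable] by simp

lemma gap_measurable[measurable]:
  "i \<in> {1..K} \<Longrightarrow> j \<in> {1..K} \<Longrightarrow> gap i j \<in> borel_measurable S"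
  unfolding gap_def by (intro borel_measurable_diff loss_measurable) measurable

lemma borel_measurable_advice:
  assumes "G \<in> A \<rightarrow>\<^sub>M restrict_space borel X"
  shows "G \<in> borel_measurable A"
  using assms by (simp add: measurable_restrict_space2_iff)

lemma sqd_measurable[measurable]:
  "i \<in> {1..K} \<Longrightarrow> j \<in> {1..K} \<Longrightarrow> sqd i j \<in> borel_measurable S"
  unfolding sqd_def
  by (intro borel_measurable_power measurable_compose[OF _ borel_measurable_norm]
      borel_measurable_diff borel_measurable_advice advice_measurable)

lemma advice_dist_le:
  assumes "y \<in> space N" "x \<in> X" "x' \<in> X"
  shows "norm (x - x') \<le> D"
  using strongly_convex_lipschitz_diameter[OF strongly_convex lipschitz X] assms \<rho>
  unfolding D_def by blast

lemma loss_diff_le: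
  assumes "y \<in> space N" "x \<in> X" "x' \<in> X"
  shows "\<bar>l x y - l x' y\<bar> \<le> L * norm (x - x')"
  using lipschitz_on_normD[OF lipschitz] assms by fastforce

lemma sqd_bound:
  assumes "i \<in> {1..K}" "j \<in> {1..K}" "z \<in> space S"
  shows "0 \<le> sqd i j z" "sqd i j z \<le> D\<^sup>2"
  using advice_dist_le[OF space_S(1) space_S(2) space_S(2), OF assms(3) assms(3,1) assms(3,2)]
  by (auto simp: sqd_def intro!: power_mono)

text \<open>Lipschitz continuity controls the loss gap by the distance of the two forecasts. The
  first bound feeds the second-moment condition of the Bernstein estimate, the second its range
  condition, through the diameter bound \<open>D\<close>.\<close>

lemma gap_bound:
  assumes "i \<in> {1..K}" "j \<in> {1..K}" "z \<in> space S"
  shows "(gap i j z)\<^sup>2 \<le> L\<^sup>2 * sqd i j z" "\<bar>gap i j z\<bar> \<le> B / 2"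
proof -
  have *: "\<bar>gap i j z\<bar> \<le> L * norm (snd z i - snd z j)"
    unfolding gap_def using assms space_S by (intro loss_diff_le)
  then show "(gap i j z)\<^sup>2 \<le> L\<^sup>2 * sqd i j z"
    using power_mono[OF *, of 2] by (simp add: sqd_def power_mult_distrib)
  have "L * norm (snd z i - snd z j) \<le> L * D"
    using advice_dist_le[OF space_S(1) space_S(2) space_S(2), OF assms(3) assms(3,1) assms(3,2)] L
    by (intro mult_left_mono) auto
  then show "\<bar>gap i j z\<bar> \<le> B / 2" using * by (simp add: L_mult_D)
qed

lemma obs_measurable[measurable]: "obs K Y F \<in> M \<rightarrow>\<^sub>M S"
  unfolding obs_def obs_space_def by measurable

lemma sample_measurable: "t \<in> {1..T} \<Longrightarrow> sample t \<in> M \<rightarrow>\<^sub>M S"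
  using iid by (auto simp: iid_copies_def indep_vars_def)

lemma prob_space_law: "prob_space law"
  unfolding law_def by (rule prob_space_distr) measurable

lemma sets_law[measurable_cong]: "sets law = sets S" and space_law: "space law = space S"
  by (simp_all add: law_def)

lemma integral_gap:
  assumes [measurable]: "i \<in> {1..K}" "j \<in> {1..K}"
  shows "(\<integral>z. gap i j z \<partial>law) = R i - R j"
proof -
  have "(\<integral>z. gap i j z \<partial>law) = (\<integral>\<omega>. gap i j (obs K Y F \<omega>) \<partial>M)"
    unfolding law_def by (rule integral_distr) measurable
  also have "\<dots> = R i - R j"
    using assms integrable_loss by (simp add: gap_def obs_def risk_def)
  finally show ?thesis .
qed

lemma Q_eq:
  assumes [measurable]: "i \<in> {1..K}" "j \<in> {1..K}"
  shows "Q i j = (\<integral>\<omega>. (norm (F i \<omega> - F j \<omega>))\<^sup>2 \<partial>M)"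
proof -
  have "Q i j = (\<integral>\<omega>. sqd i j (obs K Y F \<omega>) \<partial>M)"
    unfolding law_def Q_def by (rule integral_distr) measurable
  then show ?thesis
    using assms by (simp add: sqd_def obs_def)
qed

lemma emp_R_diff:
  assumes "i \<in> {1..K}" "j \<in> {1..K}"
  shows "emp_R i \<omega> - emp_R j \<omega> = (\<Sum>t=1..T. gap i j (sample t \<omega>)) / real T"
  using assms by (simp add: emp_risk_def gap_def obs_def sum_subtractf diff_divide_distrib)

lemma emp_d_sq:
  assumes "i \<in> {1..K}" "j \<in> {1..K}"
  shows "(emp_d i j \<omega>)\<^sup>2 = (\<Sum>t=1..T. sqd i j (sample t \<omega>)) / real T"
  using assms by (simp add: emp_dist_def sqd_def obs_def sum_nonneg)

section \<open>Deviation of empirical risks and distances\<close>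

lemma chernoff_sample:
  assumes "g \<in> borel_measurable S" "\<And>z. z \<in> space S \<Longrightarrow> g z \<le> C" "(\<integral>z. exp (g z) \<partial>law) \<le> 1"
  shows "prob {\<omega>\<in>space M. 2 * a\<^sup>2 * real T \<le> (\<Sum>t=1..T. g (sample t \<omega>))} \<le> (\<delta> / (4 * real K))\<^sup>2"
  unfolding exp_alpha[symmetric] using assms iid
  by (intro chernoff_iid[where S=S and P=law and Z=sample]) (auto simp: iid_copies_def law_def)

lemma sample_sum_measurable:
  fixes g :: "_ \<Rightarrow> real"
  shows "g \<in> borel_measurable S \<Longrightarrow> (\<lambda>\<omega>. \<Sum>t=1..T. g (sample t \<omega>)) \<in> borel_measurable M"
  using borel_measurable_sum[of "{1..T}" "\<lambda>t \<omega>. g (sample t \<omega>)" M] measurable_compose[OF sample_measurable] by blast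

text \<open>The Bernstein estimate with \<open>L\<^sup>2 * Q i j\<close> as second-moment bound.
  Multiplied by \<open>s\<close>, the deviation \<open>3 * a * m\<close> becomes
  \<open>3 * a\<^sup>2\<close>; the correction term costs at most \<open>a\<^sup>2\<close>, and the
  Chernoff level \<open>2 * a\<^sup>2\<close> remains.\<close>

lemma risk_deviation:
  assumes ij: "i \<in> {1..K}" "j \<in> {1..K}"
  shows "prob {\<omega>\<in>space M. 3 * a * max (L * sqrt (Q i j)) (B * a)
      \<le> (emp_R i \<omega> - emp_R j \<omega>) - (R i - R j)} \<le> (\<delta> / (4 * real K))\<^sup>2"
proof -
  interpret law: prob_space law by (rule prob_space_law)
  define m where "m = max (L * sqrt (Q i j)) (B * a)"
  \<comment> \<open>minimises \<open>s m\<^sup>2 + a\<^sup>2 / s\<close> up to constants; flooring \<open>m\<close> at \<open>B a\<close> keeps \<open>s\<close> in the range \<open>B s \<le> 1\<close>\<close>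
  define s where "s = a / m"
  define g where "g z = s * (gap i j z - (R i - R j)) - s\<^sup>2 * (L\<^sup>2 * Q i j)" for z
  have gap[measurable]: "gap i j \<in> borel_measurable S" using ij by simp
  have g[measurable]: "g \<in> borel_measurable S" unfolding g_def by measurable
  have Q: "0 \<le> Q i j" unfolding Q_def sqd_def by (intro integral_nonneg_AE) auto
  have Ba: "0 < B * a" using B_pos alpha_pos by simp
  then have m: "0 < m" "B * a \<le> m" "L * sqrt (Q i j) \<le> m" by (auto simp: m_def)
  have s: "0 < s" "B * s \<le> 1" "s * m = a"
    using m alpha_pos by (auto simp: s_def field_simps)
  have var: "(\<integral>z. (gap i j z)\<^sup>2 \<partial>law) \<le> L\<^sup>2 * Q i j"
  proof -
    have "integrable law (sqd i j)"
      by (rule law.integrable_const_bound[of _ "D\<^sup>2"]) (use ij sqd_bound in \<open>auto simp: space_law law_def\<close>)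
    then have "(\<integral>z. (gap i j z)\<^sup>2 \<partial>law) \<le> (\<integral>z. L\<^sup>2 * sqd i j z \<partial>law)"
      using gap_bound(1)[OF ij] sqd_bound(1)[OF ij] by (intro integral_mono') (auto simp: space_law)
    then show ?thesis by (simp add: Q_def)
  qed
  have "(L * sqrt (Q i j))\<^sup>2 \<le> m\<^sup>2"
    using m L Q by (intro power_mono) auto
  then have w: "s\<^sup>2 * (L\<^sup>2 * Q i j) \<le> a\<^sup>2"
    using Q mult_left_mono[of "L\<^sup>2 * Q i j" "m\<^sup>2" "s\<^sup>2"] s(3)
    by (simp add: power_mult_distrib) (metis power_mult_distrib)
  have "(\<integral>z. exp (g z) \<partial>law) \<le> 1"
    unfolding g_def integral_gap[OF ij, symmetric]
    by (rule law.expectation_exp_bernstein_le_1[where b="B/2"])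
       (use s gap_bound(2)[OF ij] var in \<open>auto simp: space_law mult_ac law_def\<close>)
  moreover have "g z \<le> s * (B / 2 - (R i - R j))" if "z \<in> space S" for z
  proof -
    have "s * (gap i j z - (R i - R j)) \<le> s * (B / 2 - (R i - R j))"
      using gap_bound(2)[OF ij that] s by (intro mult_left_mono) auto
    then show ?thesis using Q by (simp add: g_def add_increasing2 diff_le_eq)
  qed
  ultimately have *: "prob {\<omega>\<in>space M. 2 * a\<^sup>2 * real T \<le> (\<Sum>t=1..T. g (sample t \<omega>))} \<le> (\<delta> / (4 * real K))\<^sup>2"
    by (intro chernoff_sample) auto
  have sub: "{\<omega>\<in>space M. 3 * a * m \<le> (emp_R i \<omega> - emp_R j \<omega>) - (R i - R j)}
      \<subseteq> {\<omega>\<in>space M. 2 * a\<^sup>2 * real T \<le> (\<Sum>t=1..T. g (sample t \<omega>))}"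
  proof safe
    fix \<omega> assume "3 * a * m \<le> (emp_R i \<omega> - emp_R j \<omega>) - (R i - R j)"
    then have "s * (3 * a * m) \<le> s * ((emp_R i \<omega> - emp_R j \<omega>) - (R i - R j))"
      using s by (intro mult_left_mono) auto
    moreover have "s * (3 * a * m) = 3 * a\<^sup>2"
      using s(3) by (simp add: power2_eq_square mult_ac)
    ultimately have "2 * a\<^sup>2 \<le> s * ((emp_R i \<omega> - emp_R j \<omega>) - (R i - R j)) - s\<^sup>2 * (L\<^sup>2 * Q i j)"
      using w by linarith
    then have "2 * a\<^sup>2 * real T \<le> (s * ((emp_R i \<omega> - emp_R j \<omega>) - (R i - R j)) - s\<^sup>2 * (L\<^sup>2 * Q i j)) * real T"
      by (intro mult_right_mono) auto
    also have "\<dots> = (\<Sum>t=1..T. g (sample t \<omega>))"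
      using T unfolding emp_R_diff[OF ij]
      by (simp only: g_def sum_subtractf sum_distrib_left[symmetric]) (simp add: field_simps)
    finally show "2 * a\<^sup>2 * real T \<le> (\<Sum>t=1..T. g (sample t \<omega>))" .
  qed
  have "{\<omega>\<in>space M. 2 * a\<^sup>2 * real T \<le> (\<Sum>t=1..T. g (sample t \<omega>))} \<in> events"
    using sample_sum_measurable[OF g] by measurable
  from finite_measure_mono[OF sub this] * show ?thesis
    unfolding m_def by (rule order.trans)
qed

text \<open>Divided by \<open>D\<^sup>2\<close>, the squared distance lies in the unit interval, so
  the two linear exponential bounds apply. Allowing a relative factor 2 makes the additive error of
  order \<open>a\<^sup>2\<close> instead of \<open>a\<close>.\<close>

lemma
  assumes ij: "i \<in> {1..K}" "j \<in> {1..K}"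
  shows sqdist_lower_deviation:
      "prob {\<omega>\<in>space M. (emp_d i j \<omega>)\<^sup>2 + 2 * D\<^sup>2 * a\<^sup>2 \<le> Q i j / 2} \<le> (\<delta> / (4 * real K))\<^sup>2" (is ?lower)
    and sqdist_upper_deviation:
      "prob {\<omega>\<in>space M. 2 * Q i j + 2 * D\<^sup>2 * a\<^sup>2 \<le> (emp_d i j \<omega>)\<^sup>2} \<le> (\<delta> / (4 * real K))\<^sup>2" (is ?upper)
proof -
  interpret law: prob_space law by (rule prob_space_law)
  define f where "f z = sqd i j z / D\<^sup>2" for z
  define \<mu> where "\<mu> = (\<integral>z. f z \<partial>law)"
  have [measurable]: "sqd i j \<in> borel_measurable S" using ij by simp
  have f[measurable]: "f \<in> borel_measurable S" unfolding f_def by measurable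
  have D2: "0 < D\<^sup>2" using D_pos by (rule zero_less_power)
  have bound: "0 \<le> f z \<and> f z \<le> 1" if "z \<in> space S" for z
    using sqd_bound[OF ij that] D2 unfolding f_def by (simp only: divide_le_eq_1_pos zero_le_divide_iff) auto
  have Q: "Q i j = D\<^sup>2 * \<mu>"
    using D2 unfolding \<mu>_def f_def Q_def by (subst integral_divide_zero) simp
  have sq: "(emp_d i j \<omega>)\<^sup>2 = D\<^sup>2 * ((\<Sum>t=1..T. f (sample t \<omega>)) / real T)" for \<omega>
    using D2 unfolding emp_d_sq[OF ij] f_def by (simp only: sum_divide_distrib[symmetric]) simp
  have T': "0 < real T" using T by simp
  have "prob {\<omega>\<in>space M. 2 * a\<^sup>2 * real T \<le> (\<Sum>t=1..T. \<mu> / 2 - f (sample t \<omega>))} \<le> (\<delta> / (4 * real K))\<^sup>2"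
    using law.expectation_exp_lower_le_1[of f] bound unfolding \<mu>_def
    by (intro chernoff_sample[where C="(\<integral>z. f z \<partial>law) / 2"]) (auto simp: space_law law_def)
  \<comment> \<open>Dividing by \<open>real T\<close> and rescaling by \<open>D\<^sup>2\<close>
    identifies the Chernoff event with the deviation event.\<close>
  moreover have "2 * a\<^sup>2 * real T \<le> (\<Sum>t=1..T. \<mu> / 2 - f (sample t \<omega>)) \<longleftrightarrow>
      (emp_d i j \<omega>)\<^sup>2 + 2 * D\<^sup>2 * a\<^sup>2 \<le> Q i j / 2" for \<omega>
  proof -
    let ?s = "\<Sum>t=1..T. f (sample t \<omega>)"
    have "2 * a\<^sup>2 * real T \<le> (\<Sum>t=1..T. \<mu> / 2 - f (sample t \<omega>)) \<longleftrightarrow> ?s / real T + 2 * a\<^sup>2 \<le> \<mu> / 2"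
      using T' by (simp only: sum_subtractf) (simp add: field_simps)
    also have "\<dots> \<longleftrightarrow> D\<^sup>2 * (?s / real T + 2 * a\<^sup>2) \<le> D\<^sup>2 * (\<mu> / 2)"
      using D2 by (simp only: mult_le_cancel_left_pos)
    finally show ?thesis unfolding sq Q by (simp add: distrib_left mult_ac)
  qed
  ultimately show ?lower by simp
  have "prob {\<omega>\<in>space M. 2 * a\<^sup>2 * real T \<le> (\<Sum>t=1..T. f (sample t \<omega>) - 2 * \<mu>)} \<le> (\<delta> / (4 * real K))\<^sup>2"
    using law.expectation_exp_upper_le_1[of f] bound unfolding \<mu>_def
    by (intro chernoff_sample[where C="1 - 2 * (\<integral>z. f z \<partial>law)"]) (auto simp: space_law law_def)
  moreover have "2 * a\<^sup>2 * real T \<le> (\<Sum>t=1..T. f (sample t \<omega>) - 2 * \<mu>) \<longleftrightarrow>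
      2 * Q i j + 2 * D\<^sup>2 * a\<^sup>2 \<le> (emp_d i j \<omega>)\<^sup>2" for \<omega>
  proof -
    let ?s = "\<Sum>t=1..T. f (sample t \<omega>)"
    have "2 * a\<^sup>2 * real T \<le> (\<Sum>t=1..T. f (sample t \<omega>) - 2 * \<mu>) \<longleftrightarrow> 2 * \<mu> + 2 * a\<^sup>2 \<le> ?s / real T"
      using T' by (simp only: sum_subtractf) (simp add: field_simps)
    also have "\<dots> \<longleftrightarrow> D\<^sup>2 * (2 * \<mu> + 2 * a\<^sup>2) \<le> D\<^sup>2 * (?s / real T)"
      using D2 by (simp only: mult_le_cancel_left_pos)
    finally show ?thesis unfolding sq Q by (simp add: distrib_left mult_ac)
  qed
  ultimately show ?upper by simp
qed

section \<open>Measurability of the selection rule\<close>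

lemma advice_sample_measurable:
  assumes "t \<in> {1..T}"
  shows "i \<in> {1..K} \<Longrightarrow> Fs i t \<in> M \<rightarrow>\<^sub>M restrict_space borel X" "Ys t \<in> M \<rightarrow>\<^sub>M N"
  using measurable_compose[OF sample_measurable[OF assms] advice_measurable, of i]
    measurable_compose[OF sample_measurable[OF assms] target_measurable]
  by (simp_all add: obs_def)

lemma emp_R_measurable[measurable]:
  "i \<in> {1..K} \<Longrightarrow> emp_R i \<in> borel_measurable M"
  unfolding emp_risk_def
  by (intro borel_measurable_times borel_measurable_const borel_measurable_sum loss_measurable
      advice_sample_measurable)

lemma emp_d_measurable[measurable]:
  "i \<in> {1..K} \<Longrightarrow> j \<in> {1..K} \<Longrightarrow> emp_d i j \<in> borel_measurable M"
  unfolding emp_dist_def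
  by (intro measurable_compose[OF _ borel_measurable_sqrt] borel_measurable_times borel_measurable_const
      borel_measurable_sum borel_measurable_power measurable_compose[OF _ borel_measurable_norm] borel_measurable_diff
      borel_measurable_advice advice_sample_measurable)

text \<open>The arg max ranges over a data-dependent set. For indices in \<open>{1..K}\<close> it is
  rewritten as a finite conjunction guarded by membership; for other indices the predicate is
  constantly false.\<close>

lemma valid_choice_measurable:
  "Measurable.pred M (\<lambda>\<omega>. valid_choice l L \<rho> \<delta> K T (\<lambda>t. Ys t \<omega>) (\<lambda>i t. Fs i t \<omega>) k j)"
proof -
  let ?sel = "\<lambda>\<omega>. selected l L \<rho> \<delta> K T (\<lambda>t. Ys t \<omega>) (\<lambda>i t. Fs i t \<omega>)"
  have [measurable]: "Measurable.pred M (\<lambda>\<omega>. i \<in> ?sel \<omega>)" if "i \<in> {1..K}" for i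
    unfolding mem_selected_iff[OF K] Delta_def using that by measurable
  have sub: "?sel \<omega> \<subseteq> {1..K}" for \<omega> by (auto simp: selected_def)
  show ?thesis
  proof (cases "k \<in> {1..K} \<and> j \<in> {1..K}")
    case True
    then have [measurable]: "k \<in> {1..K}" "j \<in> {1..K}" by auto
    have "valid_choice l L \<rho> \<delta> K T (\<lambda>t. Ys t \<omega>) (\<lambda>i t. Fs i t \<omega>) k j \<longleftrightarrow>
        k \<in> ?sel \<omega> \<and> j \<in> ?sel \<omega> \<and> (\<forall>i\<in>{1..K}. i \<in> ?sel \<omega> \<longrightarrow> \<not> emp_d k j \<omega> < emp_d k i \<omega>)" for \<omega>
      using sub by (auto simp: valid_choice_def is_arg_max_def)
    then show ?thesis by simp
  next
    case False
    then have "\<not> valid_choice l L \<rho> \<delta> K T (\<lambda>t. Ys t \<omega>) (\<lambda>i t. Fs i t \<omega>) k j" for \<omega>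
      using sub[of \<omega>] unfolding valid_choice_def is_arg_max_def by blast
    then show ?thesis by simp
  qed
qed

section \<open>Risk of the averaged forecast and the union bound\<close>

lemma risk_midpoint:
  assumes ij: "i \<in> {1..K}" "j \<in> {1..K}"
  shows "risk M l Y (\<lambda>\<omega>. (1/2) *\<^sub>R (F i \<omega> + F j \<omega>)) \<le> (R i + R j) / 2 - \<rho>\<^sup>2 / 8 * Q i j"
proof -
  let ?m = "\<lambda>\<omega>. (1/2) *\<^sub>R (F i \<omega> + F j \<omega>)"
  have X': "F i \<omega> \<in> X" "F j \<omega> \<in> X" "Y \<omega> \<in> space N" if "\<omega> \<in> space M" for \<omega>
    using measurable_space[OF F that] measurable_space[OF Y that] ij by (auto simp: space_restrict_space)
  have mid: "?m \<omega> \<in> X" if "\<omega> \<in> space M" for \<omega>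
    using convexD[OF X X'(1,2)[OF that], of "1/2" "1/2"] by (simp add: scaleR_add_right)
  have [measurable]: "F i \<in> borel_measurable M" "F j \<in> borel_measurable M"
    using F ij by (auto intro: borel_measurable_advice)
  have "?m \<in> M \<rightarrow>\<^sub>M restrict_space borel X"
    using mid by (intro measurable_restrict_space2) auto
  then have m[measurable]: "(\<lambda>\<omega>. l (?m \<omega>) (Y \<omega>)) \<in> borel_measurable M"
    by (rule loss_measurable) measurable
  note int = integrable_loss[OF ij(1)] integrable_loss[OF ij(2)]
  have sq: "integrable M (\<lambda>\<omega>. (norm (F i \<omega> - F j \<omega>))\<^sup>2)"
    using advice_dist_le[OF X'(3,1,2)] D_pos by (intro integrable_const_bound[of _ "D\<^sup>2"]) (auto intro!: power_mono AE_I2)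
  \<comment> \<open>Integrability is assumed only for the losses of the experts. It passes to the
    midpoint because the loss difference to \<open>F i\<close> is bounded by
    \<open>L * D\<close>.\<close>
  have "integrable M (\<lambda>\<omega>. l (?m \<omega>) (Y \<omega>) - l (F i \<omega>) (Y \<omega>))"
  proof (rule integrable_const_bound[of _ "L * D"])
    have "\<bar>l (?m \<omega>) (Y \<omega>) - l (F i \<omega>) (Y \<omega>)\<bar> \<le> L * D" if "\<omega> \<in> space M" for \<omega>
      using loss_diff_le[OF X'(3) mid X'(1)] advice_dist_le[OF X'(3) mid X'(1)] that L
      by (meson mult_left_mono order.trans less_imp_le)
    then show "AE \<omega> in M. norm (l (?m \<omega>) (Y \<omega>) - l (F i \<omega>) (Y \<omega>)) \<le> L * D" by simp
  qed (use int in measurable)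
  from Bochner_Integration.integrable_add[OF this int(1)]
  have "integrable M (\<lambda>\<omega>. l (?m \<omega>) (Y \<omega>))" by simp
  then have "risk M l Y ?m \<le> (\<integral>\<omega>. (l (F i \<omega>) (Y \<omega>) + l (F j \<omega>) (Y \<omega>)) / 2
      - \<rho>\<^sup>2 / 8 * (norm (F i \<omega> - F j \<omega>))\<^sup>2 \<partial>M)"
    unfolding risk_def using int sq
    by (intro integral_mono strongly_convex_on_midpoint[OF strongly_convex]) (auto simp: X')
  also have "\<dots> = (R i + R j) / 2 - \<rho>\<^sup>2 / 8 * Q i j"
    using int sq by (simp add: risk_def Q_eq[OF ij])
  finally show ?thesis .
qed

theorem aggregation_risk:
  "\<P>(\<omega> in M. \<forall>k j. valid_choice l L \<rho> \<delta> K T (\<lambda>t. Ys t \<omega>) (\<lambda>i t. Fs i t \<omega>) k j \<longrightarrow>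
      risk M l Y (\<lambda>\<omega>'. (1/2) *\<^sub>R (F k \<omega>' + F j \<omega>'))
        \<le> best_risk M l K Y F + 200 * B * (ln (4 * real K / \<delta>) / real T)) \<ge> 1 - 3 * \<delta>"
  (is "prob ?good \<ge> _")
proof -
  \<comment> \<open>Ordered pairs are used, so a one-sided risk deviation suffices: the opposite
    direction belongs to the swapped pair.\<close>
  define bad where "bad = (\<lambda>(i, j).
      {\<omega>\<in>space M. 3 * a * max (L * sqrt (Q i j)) (B * a) \<le> (emp_R i \<omega> - emp_R j \<omega>) - (R i - R j)} \<union>
      ({\<omega>\<in>space M. (emp_d i j \<omega>)\<^sup>2 + 2 * D\<^sup>2 * a\<^sup>2 \<le> Q i j / 2} \<union>
       {\<omega>\<in>space M. 2 * Q i j + 2 * D\<^sup>2 * a\<^sup>2 \<le> (emp_d i j \<omega>)\<^sup>2}))"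
  let ?I = "{1..K} \<times> {1..K}"
  have bad_sets: "bad p \<in> events" if "p \<in> ?I" for p
    using that emp_R_measurable emp_d_measurable unfolding bad_def by auto
  have bad_prob: "prob (bad p) \<le> 3 * (\<delta> / (4 * real K))\<^sup>2" if "p \<in> ?I" for p
  proof -
    obtain i j where p: "p = (i, j)" and ij[measurable]: "i \<in> {1..K}" "j \<in> {1..K}"
      using \<open>p \<in> ?I\<close> by blast
    show ?thesis
      unfolding p bad_def prod.case
      using risk_deviation[OF ij] sqdist_lower_deviation[OF ij] sqdist_upper_deviation[OF ij]
      by (intro order.trans[OF measure_Un_le] order.trans[OF add_mono[OF order_refl measure_Un_le]]) auto
  qed
  have "prob (\<Union>p\<in>?I. bad p) \<le> (\<Sum>p\<in>?I. prob (bad p))"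
    by (rule finite_measure_subadditive_finite[OF _ image_subsetI[OF bad_sets]]) simp
  also have "\<dots> \<le> real (card ?I) * (3 * (\<delta> / (4 * real K))\<^sup>2)"
    using bad_prob by (rule sum_bounded_above)
  \<comment> \<open>The number of pairs cancels the square of \<open>K\<close> in the individual
    bounds.\<close>
  also have "\<dots> = 3 * \<delta> * (\<delta> / 16)"
    using K by (simp add: power2_eq_square field_simps)
  also have "\<dots> \<le> 3 * \<delta>"
    using \<delta> by (intro mult_left_le) auto
  finally have *: "prob (\<Union>p\<in>?I. bad p) \<le> 3 * \<delta>" .
  have "(\<Union>p\<in>?I. bad p) \<in> events"
    using bad_sets by (intro sets.finite_UN) simp_all
  from prob_compl[OF this] * have "1 - 3 * \<delta> \<le> prob (space M - (\<Union>p\<in>?I. bad p))"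
    by simp
  also have "\<dots> \<le> prob ?good"
  proof (rule finite_measure_mono)
    show "?good \<in> events"
      using valid_choice_measurable by measurable
    have "best_risk M l K Y F \<in> R ` {1..K}"
      unfolding best_risk_def using K by (intro Min_in) auto
    then obtain m where m: "m \<in> {1..K}" "best_risk M l K Y F = R m" by auto
    have best: "R m \<le> R i" if "i \<in> {1..K}" for i
      unfolding m(2)[symmetric] best_risk_def using that by (intro Min_le) auto
    show "space M - (\<Union>p\<in>?I. bad p) \<subseteq> ?good"
    proof safe
      fix \<omega> k j
      assume \<omega>: "\<omega> \<in> space M" "\<omega> \<notin> (\<Union>p\<in>?I. bad p)"
        and choice: "valid_choice l L \<rho> \<delta> K T (\<lambda>t. Ys t \<omega>) (\<lambda>i t. Fs i t \<omega>) k j"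
      have kj: "k \<in> {1..K}" "j \<in> {1..K}"
        using choice by (auto simp: valid_choice_def is_arg_max_def selected_def)
      have "emp_R i \<omega> - emp_R j \<omega> - (R i - R j) < 3 * a * max (L * sqrt (Q i j)) (B * a) \<and>
          Q i j / 2 < (emp_d i j \<omega>)\<^sup>2 + 2 * D\<^sup>2 * a\<^sup>2 \<and>
          (emp_d i j \<omega>)\<^sup>2 < 2 * Q i j + 2 * D\<^sup>2 * a\<^sup>2"
        if "i \<in> {1..K}" "j \<in> {1..K}" for i j
      proof -
        have "\<omega> \<notin> bad (i, j)" using \<omega> that by blast
        then show ?thesis
          using \<omega>(1) by (simp only: bad_def prod.case Un_iff mem_Collect_eq de_Morgan_disj simp_thms not_le)
      qed
      then have "(R k + R j) / 2 - \<rho>\<^sup>2 / 8 * Q k j \<le> R m + 200 * B * a\<^sup>2"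
        by (intro aggregation_bound[where R="\<lambda>i. R i" and Q=Q,
              OF K L \<rho> alpha_pos _ _ _ m(1) best choice]) (simp_all only: less_imp_le flip: D_def)
      with risk_midpoint[OF kj]
      show "risk M l Y (\<lambda>\<omega>'. (1/2) *\<^sub>R (F k \<omega>' + F j \<omega>'))
        \<le> best_risk M l K Y F + 200 * B * (ln (4 * real K / \<delta>) / real T)"
        by (simp only: m(2) alpha_sq)
    qed
  qed
  finally show ?thesis .
qed

end

theorem theorem3p1:
  "\<exists>c::real. 0 < c \<and> c \<le> abs_const_bound \<and>
    (\<forall>(X :: (real ^ 'd) set) (N :: 'y measure) (l :: real ^ 'd \<Rightarrow> 'y \<Rightarrow> real)
      (L :: real) (\<rho> :: real) (\<delta> :: real) (K :: nat) (T :: nat)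
      (M :: 'w measure) (Y :: 'w \<Rightarrow> 'y) (F :: nat \<Rightarrow> 'w \<Rightarrow> real ^ 'd)
      (Ys :: nat \<Rightarrow> 'w \<Rightarrow> 'y) (Fs :: nat \<Rightarrow> nat \<Rightarrow> 'w \<Rightarrow> real ^ 'd).
      X \<noteq> {} \<longrightarrow> closed X \<longrightarrow> convex X \<longrightarrow>
      0 < L \<longrightarrow> 0 < \<rho> \<longrightarrow> 0 < \<delta> \<longrightarrow> \<delta> < 1 \<longrightarrow> 1 \<le> K \<longrightarrow> 1 \<le> T \<longrightarrow>
      (\<lambda>(x, y). l x y) \<in> borel_measurable (restrict_space borel X \<Otimes>\<^sub>M N) \<longrightarrow>
      (\<forall>y\<in>space N. L-lipschitz_on X (\<lambda>x. l x y)) \<longrightarrow>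
      (\<forall>y\<in>space N. strongly_convex_on \<rho> X (\<lambda>x. l x y)) \<longrightarrow>
      prob_space M \<longrightarrow>
      Y \<in> M \<rightarrow>\<^sub>M N \<longrightarrow>
      (\<forall>i\<in>{1..K}. F i \<in> M \<rightarrow>\<^sub>M restrict_space borel X) \<longrightarrow>
      (\<forall>i\<in>{1..K}. integrable M (\<lambda>\<omega>. l (F i \<omega>) (Y \<omega>))) \<longrightarrow>
      iid_copies M N X K T Y F Ys Fs \<longrightarrow>
      \<P>(\<omega> in M. \<forall>k j. valid_choice l L \<rho> \<delta> K T (\<lambda>t. Ys t \<omega>) (\<lambda>i t. Fs i t \<omega>) k j \<longrightarrow>
            risk M l Y (\<lambda>\<omega>'. (1/2) *\<^sub>R (F k \<omega>' + F j \<omega>'))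
              \<le> best_risk M l K Y F + c * Bconst L \<rho> * (ln (4 * real K / \<delta>) / real T))
        \<ge> 1 - 3 * \<delta>)"
\<comment> \<open>The witness 200 is the constant of the deterministic bound; it depends neither on
  the dimension nor on any other type.\<close>
proof (intro exI[of _ "200::real"] conjI allI impI)
  show "0 < (200::real)" "200 \<le> abs_const_bound"
    by (simp_all add: abs_const_bound_def)
qed (rule expert_aggregation.aggregation_risk, rule expert_aggregation.intro, assumption,
    rule expert_aggregation_axioms.intro; (assumption | (erule bspec, assumption)))

end
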